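(* Let $V$ be a finite-dimensional vector space over $\mathbb{K}\in\{\mathbb{R},\mathbb{C}\}$ and let $m:V\otimes V\to V$ be an associative algebra structure on $V$ with unit $1\in V$. Then there exists an open neighborhood $\mathcal{U}$ of $m$ in the set of all associative algebra structures on $V$ such that every $m'\in\mathcal{U}$ is unital, i.e. there is an element $1'\in V$ with $m'(1'\otimes x)=x=m'(x\otimes 1')$ for all $x\in V$.
   Context: An associative algebra structure on $V$ is a $\mathbb{K}$-linear map $m:V\otimes V\to V$ with $m(m(x\otimes y)\otimes z)=m(x\otimes m(y\otimes z))$ for all $x,y,z\in V$ (no unit is required). The set of associative algebra structures carries the subspace topology from the finite-dimensional vector space of linear maps $V\otimes V\to V$. *)

theory Defs
  imports "HOL-Analysis.Analysis" "HOL-Library.Function_Algebras"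
begin

definition basis_of ::
  "('k::field \<Rightarrow> 'a::ab_group_add \<Rightarrow> 'a) \<Rightarrow> 'a set \<Rightarrow> 'a set \<Rightarrow> bool" where
  "basis_of s W B \<longleftrightarrow> \<not> module.dependent s B \<and> module.span s B = W"

text \<open>The usual topology of a finite-dimensional subspace \<open>W\<close> of a \<open>\<K>\<close>-vector space with scalar
  multiplication \<open>s\<close>, transported from \<open>\<K>\<^sup>n\<close> by the coordinates with respect to a basis of \<open>W\<close>.
  The topology on \<open>'a \<Rightarrow> 'k\<close> is the product topology; coordinates outside the basis are \<open>0\<close>.
  Lemma \<open>fin_dim_topology_eq\<close> shows that the choice of the basis is immaterial.\<close>

definition fin_dim_topology ::
  "('k::real_normed_field \<Rightarrow> 'a::ab_group_add \<Rightarrow> 'a) \<Rightarrow> 'a set \<Rightarrow> 'a topology" where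
  "fin_dim_topology s W =
     pullback_topology W (module.representation s (SOME B. basis_of s W B)) euclidean"

lemma openin_pullback_representation:
  fixes s :: "'k::real_normed_field \<Rightarrow> 'a::ab_group_add \<Rightarrow> 'a"
  assumes s: "vector_space s" and B: "basis_of s W B" and C: "basis_of s W C" and fin: "finite C"
    and S: "openin (pullback_topology W (module.representation s B) euclidean) S"
  shows "openin (pullback_topology W (module.representation s C) euclidean) S"
proof -
  interpret vector_space s by fact
  have iB: "independent B" "span B = W" and iC: "independent C" "span C = W"
    using B C by (auto simp: basis_of_def)
  define L :: "('a \<Rightarrow> 'k) \<Rightarrow> 'a \<Rightarrow> 'k"
    where "L f b = (\<Sum>c\<in>C. f c * representation B c b)" for f b
  have L: "representation B w = L (representation C w)" if "w \<in> W" for w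
  proof
    fix b
    have CW: "c \<in> span B" if "c \<in> C" for c
      using that iB iC span_base by auto
    have "representation B w = representation B (\<Sum>c\<in>C. s (representation C w c) c)"
      using that iC fin sum_representation_eq[of C w C] by simp
    also have "\<dots> = (\<lambda>b. \<Sum>c\<in>C. representation B (s (representation C w c) c) b)"
      using iB(1) CW by (intro representation_sum span_scale)
    finally show "representation B w b = L (representation C w) b"
      by (simp add: L_def representation_scale[OF iB(1) CW])
  qed
  have "continuous_on UNIV L"
    unfolding L_def
    by (intro continuous_on_coordinatewise_then_product continuous_intros
        continuous_on_product_coordinates)
  moreover obtain U where U: "open U" "S = representation B -` U \<inter> W"
    using S by (auto simp: openin_pullback_topology)
  ultimately have "open (L -` U)"
    by (simp add: continuous_on_open_vimage)
  moreover have "S = representation C -` (L -` U) \<inter> W"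
    using U L by auto
  ultimately show ?thesis
    by (auto simp: openin_pullback_topology)
qed

lemma fin_dim_topology_eq:
  fixes s :: "'k::real_normed_field \<Rightarrow> 'a::ab_group_add \<Rightarrow> 'a"
  assumes s: "vector_space s" and B: "basis_of s W B" and fin: "finite B"
  shows "fin_dim_topology s W = pullback_topology W (module.representation s B) euclidean"
proof -
  interpret vector_space s by fact
  define C where "C = (SOME B. basis_of s W B)"
  have C: "basis_of s W C"
    unfolding C_def using B by (rule someI)
  have "finite C"
    using independent_span_bound[of B C] fin B C span_superset by (auto simp: basis_of_def)
  then show ?thesis
    unfolding fin_dim_topology_def C_def[symmetric]
    using openin_pullback_representation[OF s B C] openin_pullback_representation[OF s C B] fin
    by (auto simp: topology_eq)
qed

text \<open>Linear maps \<open>V \<otimes> V \<rightarrow> V\<close> are represented by the corresponding bilinear maps, with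
  \<open>m x y\<close> for \<open>m (x \<otimes> y)\<close>. They form a subspace of \<open>'v \<Rightarrow> 'v \<Rightarrow> 'v\<close> with pointwise operations.\<close>

definition bilinear_maps ::
  "('k::field \<Rightarrow> 'v::ab_group_add \<Rightarrow> 'v) \<Rightarrow> ('v \<Rightarrow> 'v \<Rightarrow> 'v) set" where
  "bilinear_maps s =
     {m. (\<forall>x. Vector_Spaces.linear s s (\<lambda>y. m x y)) \<and> (\<forall>y. Vector_Spaces.linear s s (\<lambda>x. m x y))}"

definition bilinear_topology ::
  "('k::real_normed_field \<Rightarrow> 'v::ab_group_add \<Rightarrow> 'v) \<Rightarrow> ('v \<Rightarrow> 'v \<Rightarrow> 'v) topology" where
  "bilinear_topology s = fin_dim_topology (\<lambda>c m x y. s c (m x y)) (bilinear_maps s)"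

definition assoc_structures ::
  "('k::field \<Rightarrow> 'v::ab_group_add \<Rightarrow> 'v) \<Rightarrow> ('v \<Rightarrow> 'v \<Rightarrow> 'v) set" where
  "assoc_structures s = {m \<in> bilinear_maps s. \<forall>x y z. m (m x y) z = m x (m y z)}"

definition assoc_topology ::
  "('k::real_normed_field \<Rightarrow> 'v::ab_group_add \<Rightarrow> 'v) \<Rightarrow> ('v \<Rightarrow> 'v \<Rightarrow> 'v) topology" where
  "assoc_topology s = subtopology (bilinear_topology s) (assoc_structures s)"

definition unital :: "('v \<Rightarrow> 'v \<Rightarrow> 'v) \<Rightarrow> bool" where
  "unital m \<longleftrightarrow> (\<exists>e. \<forall>x. m e x = x \<and> m x e = x)"

end

theory Submission
  imports Defs
begin

text \<open>Let \<open>a\<close> be the unit of \<open>m\<close>. An associative product \<open>m'\<close> close to \<open>m\<close> need not have \<open>a\<close> as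
  its unit, but left and right multiplication by \<open>a\<close> with respect to \<open>m'\<close> are still close to the
  identity, hence bijective. This alone forces \<open>m'\<close> to be unital: if \<open>a \<cdot> e = a\<close>, then
  \<open>a \<cdot> (e \<cdot> x) = a \<cdot> x\<close>, and cancelling \<open>a\<close> makes \<open>e\<close> a left unit; symmetrically a solution of
  \<open>f \<cdot> a = a\<close> is a right unit; and \<open>e = e \<cdot> f = f\<close> (\<open>unital_if_translations_bij\<close>).

  Closeness to the identity is measured by the sum of the absolute values of the matrix entries of
  the difference. If this is below \<open>1\<close>, the map sends no nonzero vector to \<open>0\<close>, by an
  estimate in the \<open>l\<^sup>1\<close>-norm of the coordinates (\<open>linear_bij_if_identity_defect_less_1\<close>). It
  remains to see that this quantity depends continuously on \<open>m'\<close>. It is built from the structure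
  constants of \<open>m'\<close>, which are linear functions on the finite-dimensional space of bilinear maps
  and therefore continuous (\<open>continuous_map_structure_constant\<close>).\<close>

section \<open>Linear maps close to the identity\<close>

text \<open>This is the entrywise \<open>l\<^sup>1\<close>-norm of the matrix of \<open>f - id\<close>. It dominates the
  operator norm for the \<open>l\<^sup>1\<close>-norm of coordinates and, as a finite sum, is visibly
  continuous in the matrix entries of \<open>f\<close>.\<close>

definition identity_defect ::
  "('k::real_normed_field \<Rightarrow> 'v::ab_group_add \<Rightarrow> 'v) \<Rightarrow> 'v set \<Rightarrow> ('v \<Rightarrow> 'v) \<Rightarrow> real" where
  "identity_defect s B f =
     (\<Sum>b\<in>B. \<Sum>c\<in>B. norm (module.representation s B (f c) b - module.representation s B c b))"

text \<open>If \<open>f x = 0\<close>, then \<open>x = - (f x - x)\<close>, so the \<open>l\<^sup>1\<close>-norm of \<open>x\<close> is at most the defect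
  times itself and must vanish. Hence \<open>f\<close> is injective, and finite dimension makes it
  bijective.\<close>

lemma linear_bij_if_identity_defect_less_1:
  fixes s :: "'k::real_normed_field \<Rightarrow> 'v::ab_group_add \<Rightarrow> 'v"
  assumes fd: "finite_dimensional_vector_space s B" and lin: "Vector_Spaces.linear s s f"
    and less: "identity_defect s B f < 1"
  shows "bij f"
proof -
  interpret finite_dimensional_vector_space s B by fact
  interpret f: Vector_Spaces.linear s s f by fact
  let ?r = "representation B"
  let ?d = "\<lambda>b c. norm (?r (f c) b - ?r c b)"
  have inV: "v \<in> span B" for v
    using span_Basis by simp
  have "x = 0" if "f x = 0" for x
  proof -
    define N where "N = (\<Sum>b\<in>B. norm (?r x b))"
    have x: "x = (\<Sum>c\<in>B. s (?r x c) c)"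
      using sum_representation_eq[OF independent_Basis inV finite_Basis order_refl] by simp
    have coord: "norm (?r x b) \<le> N * (\<Sum>c\<in>B. ?d b c)" for b
    proof -
      have "0 = ?r (f (\<Sum>c\<in>B. s (?r x c) c)) b"
        using that x representation_zero[of B] by simp
      also have "\<dots> = (\<Sum>c\<in>B. ?r x c * ?r (f c) b)"
        by (simp add: f.sum f.scale representation_sum[OF independent_Basis inV]
            representation_scale[OF independent_Basis inV])
      finally have 1: "(\<Sum>c\<in>B. ?r x c * ?r (f c) b) = 0" by simp
      have "?r x b = ?r (\<Sum>c\<in>B. s (?r x c) c) b"
        using x by simp
      also have "\<dots> = (\<Sum>c\<in>B. ?r x c * ?r c b)"
        by (simp add: representation_sum[OF independent_Basis inV]
            representation_scale[OF independent_Basis inV])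
      finally have "norm (?r x b) = norm (\<Sum>c\<in>B. ?r x c * (?r (f c) b - ?r c b))"
        using 1 by (simp add: right_diff_distrib sum_subtractf)
      also have "\<dots> \<le> (\<Sum>c\<in>B. norm (?r x c) * ?d b c)"
        by (rule order_trans[OF norm_sum]) (simp add: norm_mult)
      also have "\<dots> \<le> (\<Sum>c\<in>B. N * ?d b c)"
        unfolding N_def
        by (intro sum_mono mult_right_mono member_le_sum) (auto simp: finite_Basis)
      finally show ?thesis by (simp add: sum_distrib_left)
    qed
    have "N \<le> (\<Sum>b\<in>B. N * (\<Sum>c\<in>B. ?d b c))"
      unfolding N_def by (intro sum_mono coord[unfolded N_def])
    also have "\<dots> = N * identity_defect s B f"
      by (simp add: identity_defect_def sum_distrib_left)
    finally have "N * (1 - identity_defect s B f) \<le> 0"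
      by (simp add: algebra_simps)
    moreover have "N \<ge> 0" by (simp add: N_def sum_nonneg)
    ultimately have "N = 0"
      using less by (simp add: mult_le_0_iff)
    then have "\<forall>b\<in>B. ?r x b = 0"
      unfolding N_def by (simp add: sum_nonneg_eq_0_iff finite_Basis)
    then show "x = 0" by (subst x) simp
  qed
  then have "inj f"
    by (auto simp: f.inj_iff_eq_0)
  then show ?thesis
    using linear_inj_imp_surj[OF lin] by (simp add: bij_def)
qed

section \<open>Units from invertible translations\<close>

text \<open>The candidates for the unit are the solutions of \<open>a \<cdot> e = a\<close> and \<open>f \<cdot> a = a\<close>, which exist by
  surjectivity of the translations; injectivity then allows \<open>a\<close> to be cancelled.\<close>

lemma unital_if_translations_bij:
  assumes assoc: "\<And>x y z. m (m x y) z = m x (m y z)"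
    and left: "bij (\<lambda>x. m a x)" and right: "bij (\<lambda>x. m x a)"
  shows "unital m"
proof -
  obtain e where e: "m a e = a" using left by (metis bij_pointE)
  obtain f where f: "m f a = a" using right by (metis bij_pointE)
  have ex: "m e x = x" for x
  proof -
    have "m a (m e x) = m a x" using e assoc by metis
    then show ?thesis using left by (auto dest: bij_is_inj injD)
  qed
  have xf: "m x f = x" for x
  proof -
    have "m (m x f) a = m x a" using f assoc by metis
    then show ?thesis using right by (auto dest!: bij_is_inj injD)
  qed
  have "e = f" using ex xf by metis
  then show ?thesis using ex xf by (auto simp: unital_def)
qed

section \<open>Continuity of structure constants\<close>

lemma vector_space_binary_maps:
  assumes "vector_space s"
  shows "vector_space (\<lambda>c (m :: 'a \<Rightarrow> 'b \<Rightarrow> 'v::ab_group_add) x y. s c (m x y))"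
proof -
  interpret vector_space s by fact
  show ?thesis
    by unfold_locales (auto simp: fun_eq_iff scale_right_distrib scale_left_distrib)
qed

lemma sum_binary_apply:
  fixes g :: "'i \<Rightarrow> 'a \<Rightarrow> 'b \<Rightarrow> 'c::comm_monoid_add"
  shows "(\<Sum>i\<in>I. g i) x y = (\<Sum>i\<in>I. g i x y)"
  by (induction I rule: infinite_finite_induct) auto

lemma subspace_bilinear_maps:
  assumes "vector_space s"
  shows "module.subspace (\<lambda>c m x y. s c (m x y)) (bilinear_maps s)"
proof -
  interpret vector_space s by fact
  interpret V2: vector_space_pair s s ..
  interpret M: vector_space "\<lambda>c m x y. s c (m x y)" by (rule vector_space_binary_maps) fact
  show ?thesis
    unfolding M.subspace_def bilinear_maps_def
    by (auto simp: V2.linear_zero V2.linear_compose_add V2.linear_compose_scale_right zero_fun_def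
        plus_fun_def)
qed

text \<open>The spanning maps send \<open>(x, y)\<close> to \<open>x\<^sub>i y\<^sub>j k\<close> for basis vectors \<open>i\<close>, \<open>j\<close>, \<open>k\<close>;
  the coefficients of \<open>m\<close> are its structure constants.\<close>

lemma bilinear_maps_finitely_spanned:
  assumes fd: "finite_dimensional_vector_space s B"
  shows "\<exists>E. finite E \<and> bilinear_maps s \<subseteq> module.span (\<lambda>c m x y. s c (m x y)) E"
proof -
  interpret finite_dimensional_vector_space s B by fact
  let ?r = "representation B"
  interpret M: vector_space "\<lambda>c m x y. s c (m x y)"
    by (rule vector_space_binary_maps) unfold_locales
  define E where "E = (\<lambda>(i, j, k) x y. s (?r x i * ?r y j) k)"
  have inV: "v \<in> span B" for v
    using span_Basis by simp
  have expand: "v = (\<Sum>c\<in>B. s (?r v c) c)" for v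
    using sum_representation_eq[OF independent_Basis inV finite_Basis order_refl] by simp
  have "m \<in> M.span (E ` (B \<times> B \<times> B))" if m: "m \<in> bilinear_maps s" for m
  proof -
    have l: "Vector_Spaces.linear s s (\<lambda>y. m x y)" and r: "Vector_Spaces.linear s s (\<lambda>x. m x y)" for x y
      using m by (auto simp: bilinear_maps_def)
    have "m = (\<Sum>i\<in>B. \<Sum>j\<in>B. \<Sum>k\<in>B. (\<lambda>x y. s (?r (m i j) k) (E (i, j, k) x y)))"
    proof (intro ext)
      fix x y
      interpret l: Vector_Spaces.linear s s "\<lambda>y. m x' y" for x' by (rule l)
      interpret r: Vector_Spaces.linear s s "\<lambda>x. m x y'" for y' by (rule r)
      have "m x y = m (\<Sum>i\<in>B. s (?r x i) i) (\<Sum>j\<in>B. s (?r y j) j)"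
        using expand by simp
      also have "\<dots> = (\<Sum>i\<in>B. s (?r x i) (m i (\<Sum>j\<in>B. s (?r y j) j)))"
        by (simp only: r.sum r.scale)
      also have "\<dots> = (\<Sum>i\<in>B. \<Sum>j\<in>B. s (?r x i * ?r y j) (m i j))"
        by (simp add: l.sum l.scale scale_sum_right)
      also have "\<dots> = (\<Sum>i\<in>B. \<Sum>j\<in>B. s (?r x i * ?r y j) (\<Sum>k\<in>B. s (?r (m i j) k) k))"
        using expand by simp
      also have "\<dots> = (\<Sum>i\<in>B. \<Sum>j\<in>B. \<Sum>k\<in>B. s (?r (m i j) k) (E (i, j, k) x y))"
        by (simp add: E_def scale_sum_right mult_ac)
      finally show "m x y = (\<Sum>i\<in>B. \<Sum>j\<in>B. \<Sum>k\<in>B. (\<lambda>x y. s (?r (m i j) k) (E (i, j, k) x y))) x y"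
        by (simp add: sum_binary_apply)
    qed
    also have "\<dots> \<in> M.span (E ` (B \<times> B \<times> B))"
      by (intro M.span_sum M.span_scale M.span_base) auto
    finally show ?thesis .
  qed
  then show ?thesis
    by (intro exI[of _ "E ` (B \<times> B \<times> B)"]) (auto simp: finite_Basis)
qed

lemma finite_basis_bilinear_maps:
  assumes fd: "finite_dimensional_vector_space s B"
  obtains C where "finite C" "basis_of (\<lambda>c m x y. s c (m x y)) (bilinear_maps s) C"
proof -
  have s: "vector_space s"
    using fd by (simp add: finite_dimensional_vector_space_def)
  interpret M: vector_space "\<lambda>c m x y. s c (m x y)"
    using s by (rule vector_space_binary_maps)
  obtain C where C: "C \<subseteq> bilinear_maps s" "M.independent C" "bilinear_maps s \<subseteq> M.span C"
    using M.maximal_independent_subset by blast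
  obtain E where E: "finite E" "bilinear_maps s \<subseteq> M.span E"
    using bilinear_maps_finitely_spanned[OF fd] by blast
  have "finite C"
    using M.independent_span_bound[OF E(1) C(2)] C(1) E(2) by auto
  moreover have "M.span C = bilinear_maps s"
    using M.span_minimal[OF C(1) subspace_bilinear_maps[OF s]] C(3) by auto
  ultimately show ?thesis
    using that C(2) by (simp add: basis_of_def)
qed

text \<open>The topology makes the coordinates of \<open>m\<close> in a basis \<open>C\<close> of the bilinear maps continuous.
  Expanding \<open>m\<close> in \<open>C\<close> exhibits each coordinate of \<open>m x y\<close> as a linear combination of these, which
  is a finite one because \<open>C\<close> is finite.\<close>

lemma continuous_map_structure_constant:
  fixes s :: "'k::real_normed_field \<Rightarrow> 'v::ab_group_add \<Rightarrow> 'v"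
  assumes fd: "finite_dimensional_vector_space s B"
  shows "continuous_map (bilinear_topology s) euclidean (\<lambda>m. module.representation s B (m x y) b)"
proof -
  interpret finite_dimensional_vector_space s B by fact
  let ?t = "\<lambda>c m x y. s c (m x y)"
  have t: "vector_space ?t" by (rule vector_space_binary_maps) unfold_locales
  interpret M: vector_space ?t by (rule t)
  obtain C where C: "finite C" "basis_of ?t (bilinear_maps s) C"
    using finite_basis_bilinear_maps[OF fd] .
  then have iC: "M.independent C" "M.span C = bilinear_maps s"
    by (auto simp: basis_of_def)
  have inV: "v \<in> span B" for v
    using span_Basis by simp
  have top: "bilinear_topology s =
      pullback_topology (bilinear_maps s) (M.representation C) euclidean"
    unfolding bilinear_topology_def using fin_dim_topology_eq[OF t C(2,1)] .
  define g where "g f = (\<Sum>c\<in>C. f c * representation B (c x y) b)" for f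
  have "continuous_on UNIV g"
    unfolding g_def by (intro continuous_intros continuous_on_product_coordinates)
  then have "continuous_map (bilinear_topology s) euclidean (g \<circ> M.representation C)"
    unfolding top by (intro continuous_map_pullback) simp
  moreover have "(g \<circ> M.representation C) m = representation B (m x y) b"
    if "m \<in> topspace (bilinear_topology s)" for m
  proof -
    have "m \<in> M.span C"
      using that iC by (simp add: top topspace_pullback_topology)
    then have "m = (\<Sum>c\<in>C. ?t (M.representation C m c) c)"
      using M.sum_representation_eq[OF iC(1) _ C(1) order_refl] by simp
    then have "m x y = (\<Sum>c\<in>C. s (M.representation C m c) (c x y))"
      by (metis (no_types, lifting) sum.cong sum_binary_apply)
    then show ?thesis
      by (simp add: g_def representation_sum[OF independent_Basis inV]
            representation_scale[OF independent_Basis inV])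
  qed
  ultimately show ?thesis
    by (rule continuous_map_eq)
qed

section \<open>Unitality is an open condition\<close>

text \<open>The neighbourhood consists of the products for which the two translations by the unit \<open>a\<close> of
  \<open>m\<close> have total defect below \<open>1\<close>. At \<open>m\<close> itself both translations are the identity, so the
  defect is \<open>0\<close>.\<close>

lemma unital_open_neighbourhood:
  fixes s :: "'k::real_normed_field \<Rightarrow> 'v::ab_group_add \<Rightarrow> 'v"
  assumes fd: "finite_dimensional_vector_space s B" and m: "m \<in> assoc_structures s" "unital m"
  shows "\<exists>U. openin (assoc_topology s) U \<and> m \<in> U \<and> (\<forall>m'\<in>U. unital m')"
proof -
  interpret finite_dimensional_vector_space s B by fact
  obtain a where a: "\<And>x. m a x = x" "\<And>x. m x a = x"
    using m(2) by (auto simp: unital_def)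
  define D where "D m' = identity_defect s B (\<lambda>x. m' a x) + identity_defect s B (\<lambda>x. m' x a)" for m'
  have nonneg: "identity_defect s B f \<ge> 0" for f
    by (simp add: identity_defect_def sum_nonneg)
  have top: "topspace (assoc_topology s) = assoc_structures s"
    by (auto simp: assoc_topology_def bilinear_topology_def fin_dim_topology_def
        topspace_pullback_topology assoc_structures_def)
  have "continuous_map (bilinear_topology s) euclideanreal D"
    unfolding D_def identity_defect_def
    by (intro continuous_map_add continuous_map_sum continuous_map_norm continuous_map_diff
        continuous_map_structure_constant[OF fd] finite_Basis) simp_all
  then have cont: "continuous_map (assoc_topology s) euclideanreal D"
    unfolding assoc_topology_def by (rule continuous_map_from_subtopology)
  define U where "U = {m' \<in> topspace (assoc_topology s). D m' \<in> {..<1}}"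
  have "openin (assoc_topology s) U"
    unfolding U_def by (rule openin_continuous_map_preimage[OF cont]) simp
  moreover have "m \<in> U"
    using m(1) by (simp add: U_def top D_def a identity_defect_def)
  moreover have "unital m'" if "m' \<in> U" for m'
  proof -
    have m': "m' \<in> assoc_structures s" "D m' < 1"
      using that by (auto simp: U_def top)
    have "bij (\<lambda>x. m' a x)" "bij (\<lambda>x. m' x a)"
      using m' nonneg[of "\<lambda>x. m' a x"] nonneg[of "\<lambda>x. m' x a"]
      by (auto intro!: linear_bij_if_identity_defect_less_1[OF fd]
          simp: D_def assoc_structures_def bilinear_maps_def)
    then show ?thesis
      using m'(1) by (intro unital_if_translations_bij) (auto simp: assoc_structures_def)
  qed
  ultimately show ?thesis by blast
qed

theorem theorem3p12:
  fixes sR :: "real \<Rightarrow> 'v::ab_group_add \<Rightarrow> 'v" and BR :: "'v set" and mR :: "'v \<Rightarrow> 'v \<Rightarrow> 'v"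
    and sC :: "complex \<Rightarrow> 'w::ab_group_add \<Rightarrow> 'w" and BC :: "'w set" and mC :: "'w \<Rightarrow> 'w \<Rightarrow> 'w"
  shows "(finite_dimensional_vector_space sR BR \<and> mR \<in> assoc_structures sR \<and> unital mR \<longrightarrow>
            (\<exists>U. openin (assoc_topology sR) U \<and> mR \<in> U \<and> (\<forall>m'\<in>U. unital m'))) \<and>
         (finite_dimensional_vector_space sC BC \<and> mC \<in> assoc_structures sC \<and> unital mC \<longrightarrow>
            (\<exists>U. openin (assoc_topology sC) U \<and> mC \<in> U \<and> (\<forall>m'\<in>U. unital m')))"
  by (intro conjI impI; elim conjE; rule unital_open_neighbourhood)

end
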